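(* Let $p$ be any prime, $m$ a positive integer, $q=p^m$, $s>1$ a positive integer, and $a\in\mu_{q^2+q+1}=\{x\in\mathbb{F}_{q^3}: x^{q^2+q+1}=1\}$. Then $$f_5(X)=2X^{q^2}+(a+a^2)X^q+\left(a^{1+q^2}+a^{2(1+q^2)}\right)X+\mathrm{Tr}_m^{3m}(X)^s\in\mathbb{F}_{q^3}[X]$$ is a permutation polynomial of $\mathbb{F}_{q^3}$ if and only if $a\neq 1$ and $\gcd(s,q-1)=1$.
   Context: $\mathrm{Tr}_m^{3m}(X)=X+X^q+X^{q^2}$ is the relative trace from $\mathbb{F}_{q^3}$ to $\mathbb{F}_q$. A polynomial $f\in\mathbb{F}_{q^3}[X]$ is a permutation polynomial of $\mathbb{F}_{q^3}$ if $c\mapsto f(c)$ is a bijection of $\mathbb{F}_{q^3}$. *)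

theory Defs
  imports "HOL-Computational_Algebra.Computational_Algebra"
begin

text \<open>
  The field with \<open>q\<^sup>3\<close> elements is a type of class \<^class>\<open>finite_field\<close> with \<open>q ^ 3\<close>
  elements, and \<open>\<mu>\<^sub>d\<close> is a subset of that type.
\<close>

definition roots_of_unity :: "nat \<Rightarrow> 'a::field set" where
  "roots_of_unity d = {x. x ^ d = 1}"

definition permutation_polynomial :: "'a::finite_field poly \<Rightarrow> bool" where
  "permutation_polynomial f \<longleftrightarrow> bij (poly f)"

text \<open>
  The indeterminate \<open>X\<close> is \<open>[:0, 1:]\<close>. The trace is taken here as a polynomial with coefficients
  in the large field.
\<close>

definition trace_poly :: "nat \<Rightarrow> 'a::field poly" where
  "trace_poly q = (let X = [:0, 1:] in X + X ^ q + X ^ (q\<^sup>2))"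

definition f5 :: "nat \<Rightarrow> nat \<Rightarrow> 'a::field \<Rightarrow> 'a poly" where
  "f5 q s a = (let X = [:0, 1:] in
     smult 2 (X ^ (q\<^sup>2)) + smult (a + a\<^sup>2) (X ^ q)
     + smult (a ^ (1 + q\<^sup>2) + a ^ (2 * (1 + q\<^sup>2))) X + trace_poly q ^ s)"

end

(* Put b = a^(1+q^2), so that b a^q = 1, and let L be the linear part of f = f5. The combination
     (a - b) L(x) + (1 - a) b^2 L(x)^q + (b - 1) a^2 L(x)^(q^2)
   vanishes identically, so the same combination of the conjugates of f(x) equals D Tr(x)^s
   with D = (a - b) (a - 1) (b - 1), which is nonzero unless a = 1. Hence f(x) determines Tr(x)^s.
   If gcd(s, q-1) = 1, then Tr(x)^s determines Tr(x), and Tr and L have no common nonzero root.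
   Conversely, if f is onto, then every element of F_q is an s-th power in F_q.
   For a = 1 all values of f lie in F_q.
   The weights come from a = v / v^q (Hilbert 90), after scaling so that v^q = 1 formally:
   the conjugates of v become a, 1, b. *)

theory Submission
  imports Defs
begin

section \<open>Characteristic, values and degrees\<close>

text \<open>Translation by 1 permutes the field, so summing \<open>x + 1\<close> over all
  \<open>x\<close> shows that the cardinality is 0 in the field.\<close>

lemma CHAR_eq_if_card_eq_prime_power:
  assumes "prime p" and "card (UNIV :: 'a::finite_field set) = p ^ n"
  shows "CHAR('a) = p"
proof -
  have c: "prime CHAR('a)"
    by (rule prime_CHAR_semidom) (simp add: finite_imp_CHAR_pos)
  have "(\<Sum>x\<in>UNIV. x + 1) = (\<Sum>x\<in>UNIV. x :: 'a)"
    by (rule sum.reindex_bij_witness[of _ "\<lambda>x. x - 1" "\<lambda>x. x + 1"]) auto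
  then have "of_nat (p ^ n) = (0 :: 'a)"
    unfolding sum.distrib by (simp flip: assms(2))
  then have "CHAR('a) dvd p ^ n"
    by (simp only: of_nat_eq_0_iff_char_dvd)
  with c assms(1) show ?thesis
    by (metis prime_dvd_power primes_dvd_imp_eq)
qed

lemma poly_trace_poly: "poly (trace_poly q) x = x + x ^ q + x ^ q\<^sup>2"
  by (simp add: trace_poly_def Let_def)

lemma poly_f5:
  "poly (f5 q s a) x = 2 * x ^ q\<^sup>2 + (a + a\<^sup>2) * x ^ q
     + (a ^ (1 + q\<^sup>2) + (a ^ (1 + q\<^sup>2))\<^sup>2) * x + poly (trace_poly q) x ^ s"
  unfolding power_mult[symmetric] by (simp add: f5_def Let_def mult.commute)

lemma degree_trace_poly:
  assumes "q > 1"
  shows "degree (trace_poly q :: 'a::field poly) = q\<^sup>2"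
proof -
  have X: "[:0, 1:] ^ n = monom (1::'a) n" for n
    by (simp add: monom_altdef)
  have "q < q\<^sup>2"
    using assms by (simp add: power2_eq_square)
  moreover have "degree ([:0, 1:] + [:0, 1:] ^ q :: 'a poly) \<le> q"
    unfolding X using assms by (intro degree_add_le) (auto simp: degree_monom_eq)
  ultimately show ?thesis
    unfolding trace_poly_def Let_def
    by (subst degree_add_eq_right) (auto simp: X degree_monom_eq)
qed

section \<open>Powers of elements fixed by Frobenius\<close>

text \<open>The extra 1 in the exponent avoids dividing by \<open>t\<close>, so that
  \<open>t = 0\<close> is covered.\<close>

lemma power_mult_plus_one_of_fixed:
  fixes t :: "'a::monoid_mult"
  assumes "t ^ q = t" and "q > 0"
  shows "t ^ ((q - 1) * k + 1) = t"
proof (induction k)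
  case (Suc k)
  have "(q - 1) * Suc k + 1 = ((q - 1) * k + 1) + (q - 1)"
    by simp
  then have "t ^ ((q - 1) * Suc k + 1) = t ^ ((q - 1) * k + 1) * t ^ (q - 1)"
    by (simp only: power_add)
  also have "\<dots> = t ^ Suc (q - 1)"
    by (simp only: Suc.IH power_Suc)
  finally show ?case using assms by simp
qed simp

text \<open>A Bezout relation \<open>s * x = (q - 1) * y + 1\<close> makes the \<open>x\<close>-th
  power undo the \<open>s\<close>-th power on fixed elements.\<close>

lemma power_inj_on_fixed:
  fixes t u :: "'a::monoid_mult"
  assumes "t ^ q = t" and "u ^ q = u" and "q > 0" and "s > 0"
    and "coprime s (q - 1)" and "t ^ s = u ^ s"
  shows "t = u"
proof -
  obtain x y where xy: "s * x = (q - 1) * y + 1"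
    using bezout_nat[of s "q - 1"] assms by auto
  have "t = t ^ (s * x)" "u = u ^ (s * x)"
    unfolding xy using assms by (simp_all only: power_mult_plus_one_of_fixed)
  with assms(6) show ?thesis
    by (simp add: power_mult)
qed

text \<open>
  The determinant of the system is \<open>(b - 1)\<^sup>2 * (a - 1) * (b - a)\<close>.
\<close>

lemma linear_system_trivial:
  fixes a b x y z :: "'a::field"
  assumes "a \<noteq> 1" "b \<noteq> 1" "a \<noteq> b"
    and "x + y + z = 0"
    and "(b + b\<^sup>2) * x + (a + a\<^sup>2) * y + 2 * z = 0"
    and "2 * b\<^sup>2 * x + (a * b + a\<^sup>2) * y + (b + 1) * z = 0"
  shows "x = 0"
proof -
  have "(b - 1)\<^sup>2 * (a - 1) * (b - a) * x = 0"
    using assms(4-6) by algebra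
  with assms(1-3) show ?thesis by simp
qed

section \<open>Frobenius and trace over the fixed field\<close>

text \<open>The prime \<open>p\<close> enters only through additivity of \<open>x ^ q\<close>. The
  subfield with \<open>q\<close> elements is represented by the equation
  \<open>y ^ q = y\<close>.\<close>

locale cubic_extension =
  fixes q :: nat and type_of_field :: "'a::finite_field itself"
  assumes q_gt_1: "q > 1"
    and card_UNIV: "card (UNIV :: 'a set) = q ^ 3"
    and frobenius_add: "\<And>x y :: 'a. (x + y) ^ q = x ^ q + y ^ q"
begin

lemma frobenius_cubed: "((x ^ q) ^ q) ^ q = (x::'a)"
  using finite_field_power_card_eq_same[of x]
  by (simp add: card_UNIV power3_eq_cube power_mult)

lemma frobenius_squared: "x ^ q\<^sup>2 = ((x::'a) ^ q) ^ q"
  by (simp add: power2_eq_square power_mult)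

lemma frobenius_diff: "(x - y) ^ q = (x::'a) ^ q - y ^ q"
  using frobenius_add[of "x - y" y] by (simp add: algebra_simps)

lemma frobenius_two: "2 ^ q = (2::'a)"
  using frobenius_add[of 1 1] by simp

lemma poly_trace_poly_fixed:
  "poly (trace_poly q) x ^ q = poly (trace_poly q) (x::'a)"
  by (simp add: poly_trace_poly frobenius_squared frobenius_add frobenius_cubed add_ac)

lemma poly_trace_poly_diff:
  "poly (trace_poly q) (x - y) = poly (trace_poly q) x - poly (trace_poly q) (y::'a)"
  by (simp add: poly_trace_poly frobenius_squared frobenius_diff)

lemma poly_identity_if_degree_less:
  fixes f g :: "'a poly"
  assumes "\<And>x. poly f x = poly g x" and "degree f < q ^ 3" and "degree g < q ^ 3"
  shows "f = g"
  using assms by (intro poly_eqI_degree[where A = UNIV]) (auto simp: card_UNIV)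

text \<open>Otherwise \<open>X ^ q\<close> and \<open>X\<close>, both of degree below
  \<open>q ^ 3\<close>, would agree everywhere and hence be equal.\<close>

lemma ex_not_fixed: "\<exists>x::'a. x ^ q \<noteq> x"
proof (rule ccontr)
  assume *: "\<not> ?thesis"
  have "q ^ 1 < q ^ 3"
    using q_gt_1 by (intro power_strict_increasing) auto
  then have "monom 1 q = (monom 1 1 :: 'a poly)"
    using * q_gt_1 by (intro poly_identity_if_degree_less) (auto simp: poly_monom degree_monom_eq)
  then have "degree (monom 1 q :: 'a poly) = degree (monom 1 1 :: 'a poly)"
    by (rule arg_cong)
  then show False
    using q_gt_1 by (simp add: degree_monom_eq)
qed

text \<open>
  If \<open>d = gcd s (q - 1) > 1\<close> and \<open>n = (q - 1) / d\<close>, then \<open>Tr ^ (n + 1) - Tr\<close> vanishes on the whole field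
  although its degree is less than \<open>q ^ 3\<close>. This avoids counting the fixed field.
\<close>

lemma coprime_if_power_surj:
  assumes surj: "\<And>y::'a. y ^ q = y \<Longrightarrow> \<exists>t. t ^ q = t \<and> y = t ^ s"
  shows "coprime s (q - 1)"
proof (rule ccontr)
  assume ncop: "\<not> ?thesis"
  define d where "d = gcd s (q - 1)"
  define n where "n = (q - 1) div d"
  have d: "d > 1"
    using ncop q_gt_1 by (auto simp: d_def coprime_iff_gcd_eq_1 nat_neq_iff)
  have nd: "n * d = q - 1"
    by (simp add: n_def d_def)
  have n0: "n > 0"
    using nd q_gt_1 by (cases n) auto
  have n: "n + 1 < q"
  proof -
    have "n * 1 < n * d" using n0 d by (intro mult_strict_left_mono) auto
    with nd show ?thesis by simp
  qed
  obtain e where e: "s = d * e"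
    by (metis d_def dvdE gcd_dvd1)
  let ?T = "trace_poly q :: 'a poly"
  have fixed: "y ^ (n + 1) = y" if y: "y ^ q = y" for y :: 'a
  proof -
    obtain t where t: "t ^ q = t" "y = t ^ s"
      using surj[OF y] by blast
    \<comment> \<open>Here \<open>s * n = (q - 1) * e\<close>. One factor \<open>t\<close> is moved
      to the second power, which then equals \<open>t\<close> even for \<open>t = 0\<close>. If
      \<open>s = 0\<close>, then \<open>y = 1\<close>.\<close>
    have "y ^ (n + 1) = t ^ (s - 1) * t ^ ((q - 1) * e + 1)" if "s > 0"
    proof -
      have "s * (n + 1) = (s - 1) + ((q - 1) * e + 1)"
        using that unfolding nd[symmetric] by (simp add: e algebra_simps)
      then show ?thesis
        by (simp only: t(2) flip: power_mult power_add)
    qed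
    then show ?thesis
      using power_mult_plus_one_of_fixed[OF t(1), of e] q_gt_1
      by (cases s) (auto simp: t(2) mult.commute)
  qed
  have deg: "degree ?T = q\<^sup>2"
    using q_gt_1 by (rule degree_trace_poly)
  then have "?T \<noteq> 0"
    using q_gt_1 by auto
  then have degp: "degree (?T ^ (n + 1)) = (n + 1) * q\<^sup>2"
    by (simp only: degree_power_eq[of ?T] deg not_False_eq_True)
  have "?T ^ (n + 1) = ?T"
  proof (rule poly_identity_if_degree_less)
    show "poly (?T ^ (n + 1)) x = poly ?T x" for x
      using fixed[OF poly_trace_poly_fixed[of x]] by simp
    have "(n + 1) * q\<^sup>2 < q * q\<^sup>2"
      using n by (intro mult_strict_right_mono) auto
    then show "degree (?T ^ (n + 1)) < q ^ 3"
      unfolding degp by (simp add: power3_eq_cube power2_eq_square)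
    show "degree ?T < q ^ 3"
      unfolding deg using q_gt_1 by (intro power_strict_increasing) auto
  qed
  then have "(n + 1) * q\<^sup>2 = q\<^sup>2"
    using degp deg by metis
  with n0 q_gt_1 show False by simp
qed

section \<open>Conjugates of the linear part\<close>

context
  fixes a a1 a2 b :: 'a
  assumes a1_def: "a1 = a ^ q" and a2_def: "a2 = a1 ^ q" and b_def: "b = a * a2"
    and norm: "a * a1 * a2 = 1" and a_neq_1: "a \<noteq> 1"
begin

lemma frobenius_a2: "a2 ^ q = a"
  by (simp add: a2_def a1_def frobenius_cubed)

text \<open>A conjugate of \<open>a\<close> equals 1 only if \<open>a\<close> does; \<open>b\<close>
  is the inverse of \<open>a1\<close>, and \<open>b = a\<close> would force
  \<open>a2 = 1\<close>.\<close>

lemma b_neq: "b \<noteq> 1" "a \<noteq> b"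
proof -
  have "a1 \<noteq> 1"
    using frobenius_cubed[of a] a_neq_1 by (auto simp flip: a1_def)
  moreover have "b * a1 = 1"
    using norm by (simp add: b_def mult_ac)
  ultimately show "b \<noteq> 1" by auto
  have "a2 \<noteq> 1"
    using frobenius_a2 a_neq_1 by auto
  moreover have "a \<noteq> 0"
    using norm by auto
  ultimately show "a \<noteq> b"
    by (simp add: b_def)
qed

text \<open>The factors \<open>b\<^sup>2\<close> and \<open>a\<^sup>2\<close> clear the conjugates
  \<open>a1\<close> and \<open>a2\<close>, leaving coefficients that are polynomials in
  \<open>a\<close> and \<open>b\<close>. The fixed \<open>t\<close> stands for the trace power or
  for 0.\<close>

lemma conjugates:
  assumes y: "y = 2 * (x ^ q) ^ q + (a + a\<^sup>2) * x ^ q + (b + b\<^sup>2) * x + t" and t: "t ^ q = t"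
  shows "b\<^sup>2 * y ^ q = 2 * b\<^sup>2 * x + (a * b + a\<^sup>2) * x ^ q + (b + 1) * (x ^ q) ^ q + b\<^sup>2 * t"
    and "a\<^sup>2 * (y ^ q) ^ q = 2 * a\<^sup>2 * x ^ q + (a + 1) * (x ^ q) ^ q + (a * b + b\<^sup>2) * x + a\<^sup>2 * t"
proof -
  have b: "b ^ q = a * a1"
    by (simp add: b_def power_mult_distrib frobenius_a2 mult.commute flip: a1_def)
  have square: "(z\<^sup>2) ^ q = (z ^ q)\<^sup>2" for z :: 'a
    by (simp flip: power_mult add: mult.commute)
  have y1: "y ^ q = 2 * x + (a1 + a1\<^sup>2) * (x ^ q) ^ q + (a * a1 + (a * a1)\<^sup>2) * x ^ q + t"
    by (simp only: y t b square frobenius_add frobenius_two power_mult_distrib frobenius_cubed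
        flip: a1_def)
  have y2: "(y ^ q) ^ q = 2 * x ^ q + (a2 + a2\<^sup>2) * x + (a1 * a2 + (a1 * a2)\<^sup>2) * (x ^ q) ^ q + t"
    by (simp only: y1 t square frobenius_add frobenius_two power_mult_distrib frobenius_cubed
        flip: a1_def a2_def)
  have "b * a1 = 1" "a * (a1 * a2) = 1"
    using norm by (simp_all add: b_def mult_ac)
  \<comment> \<open>The products are grouped so that \<open>b * a1\<close> and
    \<open>a * (a1 * a2)\<close> can be replaced by 1.\<close>
  have "b\<^sup>2 * (a1 + a1\<^sup>2) = b * (b * a1) + (b * a1)\<^sup>2"
    and "b\<^sup>2 * (a * a1 + (a * a1)\<^sup>2) = a * b * (b * a1) + a\<^sup>2 * (b * a1)\<^sup>2"
    and "a\<^sup>2 * (a1 * a2 + (a1 * a2)\<^sup>2) = a * (a * (a1 * a2)) + (a * (a1 * a2))\<^sup>2"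
    and "a\<^sup>2 * (a2 + a2\<^sup>2) = a * b + b\<^sup>2"
    unfolding b_def by (simp_all add: algebra_simps power2_eq_square)
  note coeffs = this[unfolded \<open>b * a1 = 1\<close> \<open>a * (a1 * a2) = 1\<close>]
  have "b\<^sup>2 * y ^ q = 2 * b\<^sup>2 * x + b\<^sup>2 * (a1 + a1\<^sup>2) * (x ^ q) ^ q
      + b\<^sup>2 * (a * a1 + (a * a1)\<^sup>2) * x ^ q + b\<^sup>2 * t"
    unfolding y1 by (simp only: distrib_left mult_ac)
  then show "b\<^sup>2 * y ^ q = 2 * b\<^sup>2 * x + (a * b + a\<^sup>2) * x ^ q + (b + 1) * (x ^ q) ^ q + b\<^sup>2 * t"
    unfolding coeffs by (simp add: add_ac)
  have "a\<^sup>2 * (y ^ q) ^ q = 2 * a\<^sup>2 * x ^ q + a\<^sup>2 * (a2 + a2\<^sup>2) * x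
      + a\<^sup>2 * (a1 * a2 + (a1 * a2)\<^sup>2) * (x ^ q) ^ q + a\<^sup>2 * t"
    unfolding y2 by (simp only: distrib_left mult_ac)
  then show "a\<^sup>2 * (y ^ q) ^ q = 2 * a\<^sup>2 * x ^ q + (a + 1) * (x ^ q) ^ q + (a * b + b\<^sup>2) * x + a\<^sup>2 * t"
    unfolding coeffs by (simp add: add_ac)
qed

text \<open>The trace, the linear part and its weighted conjugate give three linear equations in
  \<open>x\<close>, \<open>x ^ q\<close>, \<open>(x ^ q) ^ q\<close>, treated as independent
  unknowns.\<close>

lemma linear_part_kernel:
  assumes "x + x ^ q + (x ^ q) ^ q = 0"
    and L: "2 * (x ^ q) ^ q + (a + a\<^sup>2) * x ^ q + (b + b\<^sup>2) * x = 0"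
  shows "x = 0"
proof (rule linear_system_trivial[OF a_neq_1 b_neq assms(1)])
  show "2 * b\<^sup>2 * x + (a * b + a\<^sup>2) * x ^ q + (b + 1) * (x ^ q) ^ q = 0"
    using conjugates(1)[of 0 x 0] L q_gt_1 by (simp add: power_0_left)
qed (use L in \<open>simp add: add_ac\<close>)

text \<open>The weights sum to the coefficient of \<open>t\<close>, which is up to sign the
  Vandermonde product of \<open>a\<close>, 1, \<open>b\<close>.\<close>

lemma conjugate_combination:
  assumes y: "y = 2 * (x ^ q) ^ q + (a + a\<^sup>2) * x ^ q + (b + b\<^sup>2) * x + t" and t: "t ^ q = t"
  shows "(a - b) * y + (1 - a) * (b\<^sup>2 * y ^ q) + (b - 1) * (a\<^sup>2 * (y ^ q) ^ q)
    = (a - b) * (a - 1) * (b - 1) * t"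
  unfolding conjugates[OF assms] unfolding y by (simp add: algebra_simps power2_eq_square)

end

end

section \<open>The permutation criterion\<close>

theorem theorem3p5:
  fixes p m q s :: nat and a :: "'a::finite_field"
  assumes "prime p" and "m > 0" and "q = p ^ m"
    and "card (UNIV :: 'a set) = q ^ 3"
    and "s > 1"
    and "a \<in> roots_of_unity (q\<^sup>2 + q + 1)"
  shows "permutation_polynomial (f5 q s a) \<longleftrightarrow> a \<noteq> 1 \<and> gcd s (q - 1) = 1"
proof -
  have char: "CHAR('a) = p"
    using assms(1,3,4) by (intro CHAR_eq_if_card_eq_prime_power[of p "m * 3"]) (simp_all add: power_mult)
  interpret cubic_extension q "TYPE('a)"
  proof
    show "q > 1"
      unfolding assms(3) using assms(1,2) by (intro one_less_power prime_gt_1_nat)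
    show "(x + y) ^ q = x ^ q + y ^ q" for x y :: 'a
      by (rule freshmans_dream'[of _ m]) (simp_all add: char assms)
  qed (fact assms)
  let ?f = "poly (f5 q s a)" and ?T = "poly (trace_poly q) :: 'a \<Rightarrow> 'a"
  have bij_iff: "permutation_polynomial (f5 q s a) \<longleftrightarrow> bij ?f"
    by (simp add: permutation_polynomial_def)
  show ?thesis
  proof (cases "a = 1")
    case True
    have "?f x ^ q = ?f x" for x
    proof -
      \<comment> \<open>For \<open>a = 1\<close> all three linear coefficients are 2.\<close>
      have "?f x = 2 * ?T x + ?T x ^ s"
        by (simp add: poly_f5 True poly_trace_poly algebra_simps)
      moreover have "(?T x ^ s) ^ q = ?T x ^ s"
        by (metis poly_trace_poly_fixed power_mult mult.commute)
      ultimately show ?thesis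
        by (simp add: frobenius_add frobenius_two power_mult_distrib poly_trace_poly_fixed)
    qed
    with ex_not_fixed have "\<not> surj ?f"
      by (metis surjD)
    with True bij_iff show ?thesis
      by (simp add: bij_def)
  next
    case False
    define a1 a2 b where "a1 = a ^ q" and "a2 = a1 ^ q" and "b = a * a2"
    have "a * a1 * a2 = 1"
      using assms(6) by (simp add: roots_of_unity_def a1_def a2_def power_add power2_eq_square
          power_mult mult_ac)
    note a_facts = a1_def a2_def b_def this False
    have f: "?f x = 2 * (x ^ q) ^ q + (a + a\<^sup>2) * x ^ q + (b + b\<^sup>2) * x + ?T x ^ s" for x
      by (simp add: poly_f5 power_add frobenius_squared b_def a1_def a2_def)
    have T_s: "(?T x ^ s) ^ q = ?T x ^ s" for x
      by (metis poly_trace_poly_fixed mult.commute power_mult)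
    define D where "D = (a - b) * (a - 1) * (b - 1)"
    have "D \<noteq> 0"
      using b_neq[OF a_facts] False by (simp add: D_def)
    have comb: "(a - b) * ?f x + (1 - a) * (b\<^sup>2 * ?f x ^ q) + (b - 1) * (a\<^sup>2 * (?f x ^ q) ^ q)
        = D * ?T x ^ s" for x
      unfolding D_def by (rule conjugate_combination[OF a_facts f T_s])
    have "coprime s (q - 1)" if bij: "bij ?f"
    proof (rule coprime_if_power_surj)
      fix y :: 'a assume y: "y ^ q = y"
      obtain x where x: "?f x = y"
        using bij by (metis bij_pointE)
      \<comment> \<open>A fixed \<open>y\<close> equals its conjugates, so the combination is
        \<open>y\<close> times the sum of the weights, which is \<open>D\<close>.\<close>
      have "D * y = (a - b) * y + (1 - a) * (b\<^sup>2 * y) + (b - 1) * (a\<^sup>2 * y)"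
        by (simp add: D_def algebra_simps power2_eq_square)
      also have "\<dots> = D * ?T x ^ s"
        using comb[of x] by (simp only: x y)
      finally have "D * y = D * ?T x ^ s" .
      with \<open>D \<noteq> 0\<close> have "y = ?T x ^ s" by simp
      then show "\<exists>t. t ^ q = t \<and> y = t ^ s"
        using poly_trace_poly_fixed by blast
    qed
    moreover have "bij ?f" if cop: "coprime s (q - 1)"
    proof -
      have "inj ?f"
      proof (rule injI)
        fix x y assume eq: "?f x = ?f y"
        have "D * ?T x ^ s = D * ?T y ^ s"
          by (simp only: eq flip: comb)
        with \<open>D \<noteq> 0\<close> have "?T x ^ s = ?T y ^ s" by simp
        with cop have T: "?T x = ?T y"
          by (rule power_inj_on_fixed[OF poly_trace_poly_fixed poly_trace_poly_fixed, rotated 2])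
            (use q_gt_1 assms(5) in auto)
        \<comment> \<open>With equal traces the trace powers cancel in \<open>eq\<close>, so by
          additivity both the trace and the linear part vanish at \<open>x - y\<close>.\<close>
        have "x - y = 0"
        proof (rule linear_part_kernel[OF a_facts])
          show "(x - y) + (x - y) ^ q + ((x - y) ^ q) ^ q = 0"
            using T poly_trace_poly_diff[of x y]
            by (simp add: poly_trace_poly frobenius_squared)
          show "2 * ((x - y) ^ q) ^ q + (a + a\<^sup>2) * (x - y) ^ q + (b + b\<^sup>2) * (x - y) = 0"
            using eq T unfolding f by (simp add: frobenius_diff algebra_simps)
        qed
        then show "x = y" by simp
      qed
      then show ?thesis
        by (simp add: bij_def finite_UNIV_inj_surj)
    qed
    ultimately have "bij ?f \<longleftrightarrow> coprime s (q - 1)"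
      by (rule iffI)
    with False show ?thesis
      by (simp add: bij_iff coprime_iff_gcd_eq_1)
  qed
qed

end
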